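(* The only ultimately AC-nice linear groupoid identity (of any length) is $(xy)z=y(zx)$.
   Context: A groupoid is a set with one binary operation. A groupoid identity $u=v$ is linear of length $2n$ if the same $n$ variables occur in both terms $u$ and $v$, each exactly once on each side. Identities are considered up to renaming of variables and up to interchanging the two sides. For an integer $m>1$, a groupoid $G$ is $m$AC-nice if any two products of the same $m$ elements of $G$ (with multiplicity; in arbitrary orders and with arbitrary bracketings) yield the same element of $G$. A groupoid is ultimately AC-nice if it is $m$AC-nice for some $m\ge 3$. A linear identity is ultimately AC-nice if every groupoid satisfying it is ultimately AC-nice. *)

theory Defs
  imports Main "HOL-Library.Multiset" "HOL-Library.FuncSet"
begin

datatype 'a gterm = Var 'a | Prod "'a gterm" "'a gterm" (infixl "\<cdot>" 70)

fun leaves :: "'a gterm \<Rightarrow> 'a list" where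
  "leaves (Var x) = [x]"
| "leaves (s \<cdot> t) = leaves s @ leaves t"

text \<open>A term whose leaves are elements of a groupoid is a bracketed product of these elements.\<close>

fun eval :: "('a \<Rightarrow> 'a \<Rightarrow> 'a) \<Rightarrow> 'a gterm \<Rightarrow> 'a" where
  "eval f (Var x) = x"
| "eval f (s \<cdot> t) = f (eval f s) (eval f t)"

definition groupoid :: "'a set \<Rightarrow> ('a \<Rightarrow> 'a \<Rightarrow> 'a) \<Rightarrow> bool" where
  "groupoid G f \<longleftrightarrow> f \<in> G \<rightarrow> G \<rightarrow> G"

definition AC_nice :: "nat \<Rightarrow> 'a set \<Rightarrow> ('a \<Rightarrow> 'a \<Rightarrow> 'a) \<Rightarrow> bool" where
  "AC_nice m G f \<longleftrightarrow>
     (\<forall>s t. set (leaves s) \<subseteq> G \<and> length (leaves s) = m \<and> mset (leaves s) = mset (leaves t)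
        \<longrightarrow> eval f s = eval f t)"

definition ultimately_AC_nice :: "'a set \<Rightarrow> ('a \<Rightarrow> 'a \<Rightarrow> 'a) \<Rightarrow> bool" where
  "ultimately_AC_nice G f \<longleftrightarrow> (\<exists>m\<ge>3. AC_nice m G f)"

text \<open>The identity \<open>u = v\<close> is the pair \<open>(u, v)\<close>; variables are natural numbers.\<close>

type_synonym identity = "nat gterm \<times> nat gterm"

definition linear_identity :: "nat \<Rightarrow> identity \<Rightarrow> bool" where
  "linear_identity l e \<longleftrightarrow> (case e of (u, v) \<Rightarrow>
     distinct (leaves u) \<and> distinct (leaves v) \<and> set (leaves u) = set (leaves v) \<and>
     l = 2 * card (set (leaves u)))"

definition satisfies :: "'a set \<Rightarrow> ('a \<Rightarrow> 'a \<Rightarrow> 'a) \<Rightarrow> identity \<Rightarrow> bool" where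
  "satisfies G f e \<longleftrightarrow> (case e of (u, v) \<Rightarrow>
     \<forall>\<rho> \<in> UNIV \<rightarrow> G. eval f (map_gterm \<rho> u) = eval f (map_gterm \<rho> v))"

text \<open>HOL cannot quantify over types inside a formula, so "every groupoid" is rendered as
  every groupoid whose carrier is a subset of the type \<open>'a\<close>.  Failure of ultimate
  AC-niceness is witnessed by countably many elements, hence in a countable subgroupoid,
  so any infinite \<open>'a\<close> defines the same property of identities.\<close>

definition ultimately_AC_nice_identity :: "'a itself \<Rightarrow> identity \<Rightarrow> bool" where
  "ultimately_AC_nice_identity (_ :: 'a itself) e \<longleftrightarrow>
     (\<forall>(G :: 'a set) f. groupoid G f \<and> satisfies G f e \<longrightarrow> ultimately_AC_nice G f)"

definition same_identity :: "identity \<Rightarrow> identity \<Rightarrow> bool" where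
  "same_identity e e' \<longleftrightarrow> (case e of (u, v) \<Rightarrow>
     \<exists>\<sigma>. inj_on \<sigma> (set (leaves u) \<union> set (leaves v)) \<and>
       (e' = (map_gterm \<sigma> u, map_gterm \<sigma> v) \<or> e' = (map_gterm \<sigma> v, map_gterm \<sigma> u)))"

end

theory Submission imports Defs begin

text \<open>
  Write \<open>L p q r s = ((p q) r) s\<close>.  The identity \<open>(x y) z = y (z x)\<close> gives
  \<open>L p q r s = (p r) (q s) = L r s p q\<close>, and every product of four elements has the form \<open>L\<close>.
  For five elements, applying this symmetry both to the first four factors and to
  \<open>L (a b) c d e\<close> yields two permutations of the factors that generate all of \<open>S\<^sub>5\<close>.

  Conversely, let \<open>u = v\<close> be a linear identity.  If neither side is a left comb, then the
  groupoid in which the powers \<open>((1 1) 1) \<dots>\<close> are the only nonzero products satisfies it;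
  likewise for right combs.  If one side is a left comb and the other a right comb, each with at
  least four leaves, then the groupoid whose nonzero products are the zigzags
  \<open>(1 ((1 (1 1)) 1)) \<dots>\<close> satisfies it.  The remaining identities with at most three
  variables have equal first variables, equal last variables or follow from commutativity,
  except for the one in question.
\<close>

section \<open>The identity \<open>(xy)z = y(zx)\<close>\<close>

text \<open>Adjacent transpositions generate all permutations: the head of \<open>xs\<close> is
  carried by swaps to the front of \<open>ys\<close>, and the induction hypothesis for
  \<open>\<lambda>zs. P (x # zs)\<close> arranges the rest. Swaps are assumed only on rearrangements
  of \<open>xs\<close>, since the intended \<open>P\<close> is invariant only on lists of five
  elements of the carrier.\<close>

lemma adjacent_swap_invariant:
  assumes "\<And>as x y bs. mset (as @ x # y # bs) = mset xs \<Longrightarrow> P (as @ x # y # bs) = P (as @ y # x # bs)"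
    and "mset ys = mset xs"
  shows "P ys = P xs"
  using assms
proof (induction xs arbitrary: P ys)
  case Nil
  then show ?case by simp
next
  case (Cons x xs)
  from Cons.prems(2) have "x \<in> set ys"
    by (metis list.set_intros(1) mset_eq_setD)
  then obtain as bs where ys: "ys = as @ x # bs"
    by (meson split_list)
  have front: "P (as @ x # bs) = P (x # as @ bs)" if "mset (as @ x # bs) = mset (x # xs)" for as bs
    using that
  proof (induction as arbitrary: bs rule: rev_induct)
    case Nil
    then show ?case by simp
  next
    case (snoc a as)
    have "P (as @ a # x # bs) = P (as @ x # a # bs)"
      using snoc.prems by (intro Cons.prems(1)) simp
    also have "\<dots> = P (x # as @ a # bs)"
      using snoc.prems by (intro snoc.IH) simp
    finally show ?case by simp
  qed
  have "P (x # (as @ bs)) = P (x # xs)"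
  proof (rule Cons.IH[of "\<lambda>zs. P (x # zs)"])
    fix cs y z ds
    assume "mset (cs @ y # z # ds) = mset xs"
    then show "P (x # cs @ y # z # ds) = P (x # cs @ z # y # ds)"
      using Cons.prems(1)[of "x # cs"] by simp
  next
    show "mset (as @ bs) = mset xs"
      using Cons.prems(2) ys by simp
  qed
  with front[of as bs] Cons.prems(2) ys show ?case by simp
qed

lemma leaves_nonempty [simp]: "leaves t \<noteq> []"
  by (induction t) auto

lemma length_leaves_pos: "0 < length (leaves t)"
  by simp

lemma length_leaves_1: "length (leaves t) = 1 \<longleftrightarrow> (\<exists>a. t = Var a)"
proof (cases t)
  case (Prod p q)
  have "length (leaves p) + length (leaves q) \<noteq> 1"
    using length_leaves_pos[of p] length_leaves_pos[of q] by linarith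
  with Prod show ?thesis by simp
qed simp

lemma length_leaves_2: "length (leaves t) = 2 \<longleftrightarrow> (\<exists>a b. t = Var a \<cdot> Var b)"
proof (cases t)
  case (Prod p q)
  have "length (leaves p) + length (leaves q) = 2 \<longleftrightarrow> length (leaves p) = 1 \<and> length (leaves q) = 1"
    using length_leaves_pos[of p] length_leaves_pos[of q] by linarith
  then show ?thesis
    using Prod by (simp only: leaves.simps length_append length_leaves_1) auto
qed simp

lemma leaves_map: "leaves (map_gterm \<rho> t) = map \<rho> (leaves t)"
  by (induction t) auto

section \<open>Products of four and five factors under the cyclic law\<close>

locale cyclic_groupoid =
  fixes G :: "'a set" and f :: "'a \<Rightarrow> 'a \<Rightarrow> 'a" (infixl "\<odot>" 75)
  assumes closed [simp]: "a \<in> G \<Longrightarrow> b \<in> G \<Longrightarrow> a \<odot> b \<in> G"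
    and cyclic: "a \<in> G \<Longrightarrow> b \<in> G \<Longrightarrow> c \<in> G \<Longrightarrow> (a \<odot> b) \<odot> c = b \<odot> (c \<odot> a)"
begin

text \<open>Three uses of \<open>cyclic\<close>: forwards with the block \<open>p \<odot> q\<close>,
  backwards on the inner triple, backwards on the outer triple.\<close>

lemma product4_balanced:
  assumes "p \<in> G" "q \<in> G" "r \<in> G" "s \<in> G"
  shows "p \<odot> r \<odot> (q \<odot> s) = p \<odot> q \<odot> r \<odot> s"
proof -
  have "p \<odot> q \<odot> r \<odot> s = r \<odot> (s \<odot> (p \<odot> q))"
    using assms by (simp add: cyclic[of "p \<odot> q"])
  also have "\<dots> = r \<odot> (q \<odot> s \<odot> p)"
    using assms by (simp add: cyclic[of q s p])
  also have "\<dots> = p \<odot> r \<odot> (q \<odot> s)"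
    using assms by (simp add: cyclic[of p r])
  finally show ?thesis by simp
qed

text \<open>Expanding the inner triple first leads to the balanced product of
  \<open>r \<odot> p\<close> and \<open>s \<odot> q\<close>, which \<open>product4_balanced\<close>
  turns back into a left comb. On positions this is the double transposition (1 3)(2 4).\<close>

lemma product4_rotate:
  assumes "p \<in> G" "q \<in> G" "r \<in> G" "s \<in> G"
  shows "p \<odot> q \<odot> r \<odot> s = r \<odot> s \<odot> p \<odot> q"
proof -
  have "p \<odot> q \<odot> r \<odot> s = q \<odot> (r \<odot> p) \<odot> s"
    using assms by (simp add: cyclic[of p q r])
  also have "\<dots> = r \<odot> p \<odot> (s \<odot> q)"
    using assms by (simp add: cyclic[of q "r \<odot> p" s])
  also have "\<dots> = r \<odot> s \<odot> p \<odot> q"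
    using assms by (simp add: product4_balanced[of r s p q])
  finally show ?thesis .
qed

abbreviation (input) N where
  "N a b c d e \<equiv> a \<odot> b \<odot> c \<odot> d \<odot> e"

text \<open>Here \<open>product4_rotate\<close> takes the block \<open>a \<odot> b\<close> as one
  factor, and \<open>product4_balanced\<close> flattens the result. On positions this is a 3-cycle
  on 1, 2, 4 times the transposition of 3 and 5.\<close>

lemma product5_permute:
  assumes "a \<in> G" "b \<in> G" "c \<in> G" "d \<in> G" "e \<in> G"
  shows "N a b c d e = N d a e b c"
proof -
  have "N a b c d e = d \<odot> e \<odot> (a \<odot> b) \<odot> c"
    using assms by (simp add: product4_rotate[of "a \<odot> b" c d e])
  then show ?thesis
    using assms by (simp add: product4_balanced)
qed

text \<open>The cube of \<open>product5_permute\<close> is the transposition of positions 3 and 5,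
  its square a 3-cycle on 1, 2, 4. Conjugating the transposition by \<open>double\<close> and by
  transpositions already found yields more of them, and finally the adjacent ones.\<close>

lemma product5_swaps:
  assumes "a \<in> G" "b \<in> G" "c \<in> G" "d \<in> G" "e \<in> G"
  shows "N a b c d e = N b a c d e" "N a b c d e = N a c b d e"
    "N a b c d e = N a b d c e" "N a b c d e = N a b c e d"
proof -
  have double: "N a b c d e = N c d a b e"
    if "a \<in> G" "b \<in> G" "c \<in> G" "d \<in> G" "e \<in> G" for a b c d e
    using that by (simp add: product4_rotate[of a b c d])
  have swap35: "N a b c d e = N a b e d c"
    if "a \<in> G" "b \<in> G" "c \<in> G" "d \<in> G" "e \<in> G" for a b c d e
    using that by (simp only: product5_permute[of a b c d e] product5_permute[of d a e b c] product5_permute[of b d c a e])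
  have cycle124: "N a b c d e = N b d c a e"
    if "a \<in> G" "b \<in> G" "c \<in> G" "d \<in> G" "e \<in> G" for a b c d e
    using that by (simp only: product5_permute[of a b c d e] product5_permute[of d a e b c])
  have swap15: "N a b c d e = N e b c d a"
    if "a \<in> G" "b \<in> G" "c \<in> G" "d \<in> G" "e \<in> G" for a b c d e
    using that by (simp only: double[of a b c d e] swap35[of c d a b e] double[of c d e b a])
  have swap13: "N a b c d e = N c b a d e"
    if "a \<in> G" "b \<in> G" "c \<in> G" "d \<in> G" "e \<in> G" for a b c d e
    using that by (simp only: swap15[of a b c d e] swap35[of e b c d a] swap15[of e b a d c])
  have swap24: "N a b c d e = N a d c b e"
    if "a \<in> G" "b \<in> G" "c \<in> G" "d \<in> G" "e \<in> G" for a b c d e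
    using that by (simp only: double[of a b c d e] swap13[of c d a b e])
  \<comment> \<open>A 3-cycle followed by a transposition of two of its positions is a
    transposition.\<close>
  have swap12: "N a b c d e = N b a c d e"
    if "a \<in> G" "b \<in> G" "c \<in> G" "d \<in> G" "e \<in> G" for a b c d e
    using that by (simp only: cycle124[of a b c d e] swap24[of b d c a e])
  have swap23: "N a b c d e = N a c b d e"
    if "a \<in> G" "b \<in> G" "c \<in> G" "d \<in> G" "e \<in> G" for a b c d e
    using that by (simp only: swap12[of a b c d e] swap13[of b a c d e] swap12[of c a b d e])
  have swap34: "N a b c d e = N a b d c e"
    if "a \<in> G" "b \<in> G" "c \<in> G" "d \<in> G" "e \<in> G" for a b c d e
    using that by (simp only: swap23[of a b c d e] swap24[of a c b d e] swap23[of a d b c e])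
  have swap45: "N a b c d e = N a b c e d"
    if "a \<in> G" "b \<in> G" "c \<in> G" "d \<in> G" "e \<in> G" for a b c d e
    using that by (simp only: swap34[of a b c d e] swap35[of a b d c e] swap34[of a b e c d])
  show "N a b c d e = N b a c d e"
    using assms by (rule swap12)
  show "N a b c d e = N a c b d e"
    using assms by (rule swap23)
  show "N a b c d e = N a b d c e"
    using assms by (rule swap34)
  show "N a b c d e = N a b c e d"
    using assms by (rule swap45)
qed

text \<open>On five elements this is \<open>N\<close>; the list form makes the four swaps amenable
  to \<open>adjacent_swap_invariant\<close>.\<close>

definition left_product :: "'a list \<Rightarrow> 'a" where
  "left_product xs = foldl f (hd xs) (tl xs)"

lemma left_product_perm:
  assumes "length xs = 5" "set xs \<subseteq> G" "mset ys = mset xs"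
  shows "left_product ys = left_product xs"
proof (rule adjacent_swap_invariant[OF _ assms(3)])
  fix as x y bs
  assume *: "mset (as @ x # y # bs) = mset xs"
  have len: "length as + length bs = 3"
    using assms(1) mset_eq_length[OF *] by simp
  have G: "set (as @ x # y # bs) \<subseteq> G"
    using assms(2) mset_eq_setD[OF *] by simp
  from len consider "length as = 0" "length bs = 3" | "length as = 1" "length bs = 2"
    | "length as = 2" "length bs = 1" | "length as = 3" "length bs = 0"
    by linarith
  then show "left_product (as @ x # y # bs) = left_product (as @ y # x # bs)"
  proof cases
    case 1
    then obtain a b c where "as = []" "bs = [a, b, c]"
      by (auto simp: numeral_eq_Suc length_Suc_conv)
    with G show ?thesis
      by (simp add: left_product_def product5_swaps(1)[of x y])
  next
    case 2
    then obtain a b c where "as = [a]" "bs = [b, c]"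
      by (auto simp: numeral_eq_Suc length_Suc_conv)
    with G show ?thesis
      by (simp add: left_product_def product5_swaps(2)[of a x y])
  next
    case 3
    then obtain a b c where "as = [a, b]" "bs = [c]"
      by (auto simp: numeral_eq_Suc length_Suc_conv)
    with G show ?thesis
      by (simp add: left_product_def product5_swaps(3)[of a b x y])
  next
    case 4
    then obtain a b c where "as = [a, b, c]" "bs = []"
      by (auto simp: numeral_eq_Suc length_Suc_conv)
    with G show ?thesis
      by (simp add: left_product_def product5_swaps(4)[of a b c x y])
  qed
qed

section \<open>Left-bracketed normal forms\<close>

text \<open>Rebracketing by \<open>cyclic\<close> changes the order of the factors. Only their
  multiset is recorded, because \<open>left_product_perm\<close> later absorbs the order.\<close>

lemma product3_cases:
  assumes "set (leaves t) \<subseteq> G" "length (leaves t) = 3"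
  obtains p q r where "p \<in> G" "q \<in> G" "r \<in> G"
    "mset (leaves t) = {#p, q, r#}" "eval f t = p \<odot> q \<odot> r"
proof (cases t)
  case (Var a)
  with assms show ?thesis by simp
next
  case (Prod u v)
  with assms(2) have "length (leaves u) + length (leaves v) = 3"
    by simp
  then consider "length (leaves u) = 1" "length (leaves v) = 2"
    | "length (leaves u) = 2" "length (leaves v) = 1"
    using length_leaves_pos[of u] length_leaves_pos[of v] by linarith
  then show ?thesis
  proof cases
    case 1
    then obtain a b c where "t = Var a \<cdot> (Var b \<cdot> Var c)"
      using Prod length_leaves_1 length_leaves_2 by metis
    then show ?thesis
      using assms cyclic[of c a b] by (intro that[of c a b]) auto
  next
    case 2
    then obtain a b c where "t = (Var a \<cdot> Var b) \<cdot> Var c"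
      using Prod length_leaves_1 length_leaves_2 by metis
    then show ?thesis
      using assms by (intro that[of a b c]) auto
  qed
qed

lemma product4_cases:
  assumes "set (leaves t) \<subseteq> G" "length (leaves t) = 4"
  obtains p q r s where "p \<in> G" "q \<in> G" "r \<in> G" "s \<in> G"
    "mset (leaves t) = {#p, q, r, s#}" "eval f t = p \<odot> q \<odot> r \<odot> s"
proof (cases t)
  case (Var a)
  with assms show ?thesis by simp
next
  case (Prod u v)
  with assms(2) have "length (leaves u) + length (leaves v) = 4"
    by simp
  then consider "length (leaves u) = 1" "length (leaves v) = 3"
    | "length (leaves u) = 2" "length (leaves v) = 2"
    | "length (leaves u) = 3" "length (leaves v) = 1"
    using length_leaves_pos[of u] length_leaves_pos[of v] by linarith
  then show ?thesis
  proof cases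
    case 1
    then obtain a where a: "u = Var a" "a \<in> G"
      using Prod assms length_leaves_1[of u] by auto
    from 1 Prod assms obtain p q r where v: "p \<in> G" "q \<in> G" "r \<in> G"
      "mset (leaves v) = {#p, q, r#}" "eval f v = p \<odot> q \<odot> r"
      by (auto elim: product3_cases[of v])
    \<comment> \<open>Reading \<open>cyclic\<close> backwards draws the lone left factor into a
      balanced product.\<close>
    have "eval f t = r \<odot> a \<odot> (p \<odot> q)"
      using Prod a v by (simp add: cyclic[of r a "p \<odot> q"])
    also have "\<dots> = r \<odot> p \<odot> a \<odot> q"
      using a v by (simp add: product4_balanced)
    finally show ?thesis
      using Prod a v by (intro that[of r p a q]) auto
  next
    case 2
    then obtain a b c d where "t = (Var a \<cdot> Var b) \<cdot> (Var c \<cdot> Var d)"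
      using Prod length_leaves_2 by metis
    then show ?thesis
      using assms product4_balanced[of a c b d] by (intro that[of a c b d]) auto
  next
    case 3
    then obtain a where a: "v = Var a" "a \<in> G"
      using Prod assms length_leaves_1[of v] by auto
    from 3 Prod assms obtain p q r where "p \<in> G" "q \<in> G" "r \<in> G"
      "mset (leaves u) = {#p, q, r#}" "eval f u = p \<odot> q \<odot> r"
      by (auto elim: product3_cases[of u])
    then show ?thesis
      using Prod a by (intro that[of p q r a]) auto
  qed
qed

text \<open>Both parts are first normalized. Then \<open>product4_balanced\<close>, with a composite
  factor where needed, moves the outer brackets to the left, and \<open>cyclic\<close> removes an
  inner right bracket that may remain.\<close>

lemma product5_cases:
  assumes "set (leaves t) \<subseteq> G" "length (leaves t) = 5"
  obtains p q r s x where "p \<in> G" "q \<in> G" "r \<in> G" "s \<in> G" "x \<in> G"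
    "mset (leaves t) = {#p, q, r, s, x#}" "eval f t = N p q r s x"
proof (cases t)
  case (Var a)
  with assms show ?thesis by simp
next
  case (Prod u v)
  with assms(2) have "length (leaves u) + length (leaves v) = 5"
    by simp
  then consider "length (leaves u) = 1" "length (leaves v) = 4"
    | "length (leaves u) = 2" "length (leaves v) = 3"
    | "length (leaves u) = 3" "length (leaves v) = 2"
    | "length (leaves u) = 4" "length (leaves v) = 1"
    using length_leaves_pos[of u] length_leaves_pos[of v] by linarith
  then show ?thesis
  proof cases
    case 1
    then obtain a where a: "u = Var a" "a \<in> G"
      using Prod assms length_leaves_1[of u] by auto
    from 1 Prod assms obtain p q r s where v: "p \<in> G" "q \<in> G" "r \<in> G" "s \<in> G"
      "mset (leaves v) = {#p, q, r, s#}" "eval f v = p \<odot> q \<odot> r \<odot> s"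
      by (auto elim: product4_cases[of v])
    have "eval f t = s \<odot> a \<odot> (p \<odot> q \<odot> r)"
      using Prod a v by (simp add: cyclic[of s a "p \<odot> q \<odot> r"])
    also have "\<dots> = s \<odot> (p \<odot> q) \<odot> a \<odot> r"
      using a v by (simp add: product4_balanced[of s "p \<odot> q" a r])
    also have "\<dots> = N q s p a r"
      using a v by (simp add: cyclic[of q s p])
    finally show ?thesis
      using Prod a v by (intro that[of q s p a r]) auto
  next
    case 2
    then obtain a b where u: "u = Var a \<cdot> Var b" "a \<in> G" "b \<in> G"
      using Prod assms length_leaves_2[of u] by auto
    from 2 Prod assms obtain p q r where v: "p \<in> G" "q \<in> G" "r \<in> G"
      "mset (leaves v) = {#p, q, r#}" "eval f v = p \<odot> q \<odot> r"
      by (auto elim: product3_cases[of v])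
    have "eval f t = a \<odot> (p \<odot> q) \<odot> b \<odot> r"
      using Prod u v by (simp add: product4_balanced[of a "p \<odot> q" b r])
    also have "\<dots> = N q a p b r"
      using u v by (simp add: cyclic[of q a p])
    finally show ?thesis
      using Prod u v by (intro that[of q a p b r]) auto
  next
    case 3
    then obtain a b where v: "v = Var a \<cdot> Var b" "a \<in> G" "b \<in> G"
      using Prod assms length_leaves_2[of v] by auto
    from 3 Prod assms obtain p q r where u: "p \<in> G" "q \<in> G" "r \<in> G"
      "mset (leaves u) = {#p, q, r#}" "eval f u = p \<odot> q \<odot> r"
      by (auto elim: product3_cases[of u])
    have "eval f t = N p q a r b"
      using Prod u v by (simp add: product4_balanced[of "p \<odot> q" a r b])
    then show ?thesis
      using Prod u v by (intro that[of p q a r b]) auto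
  next
    case 4
    then obtain a where a: "v = Var a" "a \<in> G"
      using Prod assms length_leaves_1[of v] by auto
    from 4 Prod assms obtain p q r s where "p \<in> G" "q \<in> G" "r \<in> G" "s \<in> G"
      "mset (leaves u) = {#p, q, r, s#}" "eval f u = p \<odot> q \<odot> r \<odot> s"
      by (auto elim: product4_cases[of u])
    then show ?thesis
      using Prod a by (intro that[of p q r s a]) auto
  qed
qed

lemma AC_nice_5: "AC_nice 5 G f"
  unfolding AC_nice_def
proof (intro allI impI)
  fix s t
  assume *: "set (leaves s) \<subseteq> G \<and> length (leaves s) = 5 \<and> mset (leaves s) = mset (leaves t)"
  have normal: "\<exists>xs. mset xs = mset (leaves t) \<and> eval f t = left_product xs"
    if t: "set (leaves t) \<subseteq> G" "length (leaves t) = 5" for t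
  proof -
    obtain p q r s x where "mset (leaves t) = {#p, q, r, s, x#}" "eval f t = N p q r s x"
      by (rule product5_cases[OF t])
    then show ?thesis
      by (intro exI[of _ "[p, q, r, s, x]"]) (simp add: left_product_def)
  qed
  obtain xs where xs: "mset xs = mset (leaves s)" "eval f s = left_product xs"
    using normal[of s] * by blast
  have "set (leaves t) \<subseteq> G" "length (leaves t) = 5"
    using * mset_eq_setD[of "leaves s" "leaves t"] mset_eq_length[of "leaves s" "leaves t"] by auto
  then obtain ys where ys: "mset ys = mset (leaves t)" "eval f t = left_product ys"
    using normal[of t] by blast
  have "left_product ys = left_product xs"
    using * xs(1) ys(1) mset_eq_length[OF xs(1)] mset_eq_setD[OF xs(1)]
    by (intro left_product_perm) auto
  with xs(2) ys(2) show "eval f s = eval f t" by simp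
qed

end

section \<open>Counterexamples on the natural numbers\<close>

lemma eval_map_conj:
  assumes "inj \<phi>"
  shows "eval (\<lambda>a b. \<phi> (g (inv \<phi> a) (inv \<phi> b))) (map_gterm \<phi> t) = \<phi> (eval g t)"
  by (induction t) (simp_all add: assms)

text \<open>One groupoid on the natural numbers has to violate niceness for every
  \<open>m = Suc k\<close> from 3 on. An injection \<open>\<phi>\<close> copies it to the carrier
  \<open>range \<phi>\<close>.\<close>

lemma not_ultimately_AC_nice_identity:
  fixes g :: "nat \<Rightarrow> nat \<Rightarrow> nat"
  assumes inf: "infinite (UNIV :: 'a set)"
    and sat: "\<And>\<rho>. eval g (map_gterm \<rho> u) = eval g (map_gterm \<rho> v)"
    and wit: "\<And>k. 2 \<le> k \<Longrightarrow> \<exists>s t. length (leaves s) = Suc k \<and> mset (leaves s) = mset (leaves t)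
      \<and> eval g s \<noteq> eval g t"
  shows "\<not> ultimately_AC_nice_identity TYPE('a) (u, v)"
proof
  assume nice: "ultimately_AC_nice_identity TYPE('a) (u, v)"
  obtain \<phi> :: "nat \<Rightarrow> 'a" where \<phi>: "inj \<phi>"
    using inf infinite_countable_subset by blast
  define f where "f a b = \<phi> (g (inv \<phi> a) (inv \<phi> b))" for a b
  have eval_f: "eval f (map_gterm \<phi> t) = \<phi> (eval g t)" for t
    unfolding f_def using eval_map_conj[OF \<phi>] .
  have "eval f (map_gterm \<rho> u) = eval f (map_gterm \<rho> v)" if "\<rho> \<in> UNIV \<rightarrow> range \<phi>" for \<rho>
  proof -
    \<comment> \<open>As \<open>\<rho>\<close> takes values in the range, where
      \<open>inv \<phi>\<close> is a true inverse, it is the copy of an assignment of natural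
      numbers.\<close>
    have "\<rho> = \<phi> \<circ> (inv \<phi> \<circ> \<rho>)"
      using that by (simp add: fun_eq_iff Pi_iff f_inv_into_f)
    then have "map_gterm \<rho> t = map_gterm \<phi> (map_gterm (inv \<phi> \<circ> \<rho>) t)" for t
      by (simp add: gterm.map_comp)
    then show ?thesis
      by (simp add: eval_f sat)
  qed
  moreover have "groupoid (range \<phi>) f"
    by (auto simp: groupoid_def f_def)
  ultimately have "ultimately_AC_nice (range \<phi>) f"
    using nice by (simp add: ultimately_AC_nice_identity_def satisfies_def)
  then obtain m where m: "3 \<le> m" "AC_nice m (range \<phi>) f"
    unfolding ultimately_AC_nice_def by blast
  have "Suc (m - 1) = m" "2 \<le> m - 1"
    using m(1) by auto
  with wit[of "m - 1"] obtain s t where st: "length (leaves s) = m" "mset (leaves s) = mset (leaves t)"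
    "eval g s \<noteq> eval g t"
    by metis
  have "set (leaves (map_gterm \<phi> s)) \<subseteq> range \<phi>" "length (leaves (map_gterm \<phi> s)) = m"
    "mset (leaves (map_gterm \<phi> s)) = mset (leaves (map_gterm \<phi> t))"
    using st(1,2) by (auto simp: leaves_map)
  then have "eval f (map_gterm \<phi> s) = eval f (map_gterm \<phi> t)"
    using m(2) unfolding AC_nice_def by blast
  then show False
    using \<phi> st(3) by (simp add: eval_f inj_eq)
qed

section \<open>Projections and a commutative operation\<close>

lemma exists_term_with_leaves: "xs \<noteq> [] \<Longrightarrow> \<exists>t. leaves t = xs"
proof (induction xs rule: list_nonempty_induct)
  case (single x)
  then show ?case by (intro exI[of _ "Var x"]) simp
next
  case (cons x xs)
  then obtain t where "leaves t = xs" by blast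
  then show ?case by (intro exI[of _ "Var x \<cdot> t"]) simp
qed

lemma eval_left_zero: "eval (\<lambda>x y. x) t = hd (leaves t)"
  by (induction t) auto

lemma eval_right_zero: "eval (\<lambda>x y. y) t = last (leaves t)"
  by (induction t) auto

text \<open>Meant for operations whose products depend only on the list of leaves, so that any
  bracketing can serve as a witness.\<close>

lemma witness_of_leaves:
  assumes "length xs = Suc k" "mset xs = mset ys" "\<And>s t. leaves s = xs \<Longrightarrow> leaves t = ys \<Longrightarrow> eval g s \<noteq> eval g t"
  shows "\<exists>s t. length (leaves s) = Suc k \<and> mset (leaves s) = mset (leaves t) \<and> eval g s \<noteq> eval g t"
proof -
  have "xs \<noteq> []" "ys \<noteq> []"
    using assms(1,2) by auto
  then obtain s t where "leaves s = xs" "leaves t = ys"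
    using exists_term_with_leaves by meson
  then show ?thesis
    using assms by blast
qed

text \<open>The left projection evaluates a term to its first leaf. It satisfies the identity, but
  moving a 0 from the front of a word of ones to its end changes the value.\<close>

lemma not_nice_if_hd_eq:
  assumes "infinite (UNIV :: 'a set)" "hd (leaves u) = hd (leaves v)"
  shows "\<not> ultimately_AC_nice_identity TYPE('a) (u, v)"
proof (rule not_ultimately_AC_nice_identity[of "\<lambda>x y. x", OF assms(1)])
  fix k :: nat
  assume "2 \<le> k"
  then show "\<exists>s t. length (leaves s) = Suc k \<and> mset (leaves s) = mset (leaves t)
      \<and> eval (\<lambda>x y. x :: nat) s \<noteq> eval (\<lambda>x y. x) t"
    by (intro witness_of_leaves[of "0 # replicate k 1" _ "replicate k 1 @ [0]"])
      (auto simp: eval_left_zero hd_append)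
qed (simp add: eval_left_zero leaves_map hd_map assms(2))

lemma not_nice_if_last_eq:
  assumes "infinite (UNIV :: 'a set)" "last (leaves u) = last (leaves v)"
  shows "\<not> ultimately_AC_nice_identity TYPE('a) (u, v)"
proof (rule not_ultimately_AC_nice_identity[of "\<lambda>x y. y", OF assms(1)])
  fix k :: nat
  assume "2 \<le> k"
  then show "\<exists>s t. length (leaves s) = Suc k \<and> mset (leaves s) = mset (leaves t)
      \<and> eval (\<lambda>x y. y :: nat) s \<noteq> eval (\<lambda>x y. y) t"
    by (intro witness_of_leaves[of "0 # replicate k 1" _ "replicate k 1 @ [0]"])
      (auto simp: eval_right_zero)
qed (simp add: eval_right_zero leaves_map last_map assms(2))

text \<open>Under \<open>2 * x + 2 * y\<close> a leaf at depth d is weighted by 2^d, so a single 1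
  among zeros reveals its depth, which depends on the bracketing.\<close>

lemma not_nice_if_commutative:
  assumes "infinite (UNIV :: 'a set)"
    and "\<And>(g :: nat \<Rightarrow> nat \<Rightarrow> nat) \<rho>. (\<And>x y. g x y = g y x) \<Longrightarrow>
      eval g (map_gterm \<rho> u) = eval g (map_gterm \<rho> v)"
  shows "\<not> ultimately_AC_nice_identity TYPE('a) (u, v)"
proof (rule not_ultimately_AC_nice_identity[of "\<lambda>x y. 2 * x + 2 * y", OF assms(1)])
  fix k :: nat
  assume "2 \<le> k"
  have zero: "eval (\<lambda>x y. 2 * x + 2 * y) t = 0" if "set (leaves t) \<subseteq> {0 :: nat}" for t
    using that by (induction t) auto
  from \<open>2 \<le> k\<close> obtain j where j: "k = Suc j" "j \<noteq> 0"
    by (cases k) auto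
  obtain s t :: "nat gterm" where "leaves s = replicate (Suc j) 0" "leaves t = replicate j 0"
    using exists_term_with_leaves[of "replicate (Suc j) 0"] exists_term_with_leaves[of "replicate j 0"] j(2)
    by auto
  \<comment> \<open>Both witnesses have \<open>Suc (Suc j)\<close> leaves; the 1 has depth 1 in the
    first and 2 in the second, so the values are 2 and 4.\<close>
  with j show "\<exists>s t. length (leaves s) = Suc k \<and> mset (leaves s) = mset (leaves t)
      \<and> eval (\<lambda>x y. 2 * x + 2 * y :: nat) s \<noteq> eval (\<lambda>x y. 2 * x + 2 * y) t"
    by (intro exI[of _ "Var 1 \<cdot> s"] exI[of _ "(Var 1 \<cdot> Var 0) \<cdot> t"])
      (auto simp: zero)
qed (rule assms(2), simp)

text \<open>
  In the next three groupoids 0 is absorbing and a positive number \<open>n\<close> stands for the only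
  nonzero product of \<open>n\<close> factors 1.
\<close>

definition left_power :: "nat \<Rightarrow> nat \<Rightarrow> nat" where
  "left_power x y = (if y = 1 \<and> 1 \<le> x then Suc x else 0)"

definition right_power :: "nat \<Rightarrow> nat \<Rightarrow> nat" where
  "right_power x y = (if x = 1 \<and> 1 \<le> y then Suc y else 0)"

definition zigzag_power :: "nat \<Rightarrow> nat \<Rightarrow> nat" where
  "zigzag_power x y =
    (if y = 1 \<and> odd x then Suc x else if x = 1 \<and> even y \<and> y \<noteq> 0 then Suc y else 0)"

section \<open>Combs and the vanishing of terms in the power groupoids\<close>

fun left_comb :: "'a gterm \<Rightarrow> bool" where
  "left_comb (Var x) = True"
| "left_comb (s \<cdot> t) \<longleftrightarrow> left_comb s \<and> length (leaves t) = 1"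

fun right_comb :: "'a gterm \<Rightarrow> bool" where
  "right_comb (Var x) = True"
| "right_comb (s \<cdot> t) \<longleftrightarrow> right_comb t \<and> length (leaves s) = 1"

text \<open>In such a term some right factor is itself a product. No product equals 1, so that
  factor produces 0, which is absorbing.\<close>

lemma eval_left_power_eq_0: "\<not> left_comb t \<Longrightarrow> eval left_power (map_gterm \<rho> t) = 0"
proof (induction t)
  case (Prod s t)
  have zero: "left_power 0 a = 0" and nested: "left_power c (left_power a b) = 0" for a b c
    by (simp_all add: left_power_def)
  show ?case
  proof (cases t)
    case (Prod p q)
    then show ?thesis by (simp add: nested zero)
  qed (use Prod in \<open>auto simp: zero\<close>)
qed simp

lemma eval_right_power_eq_0: "\<not> right_comb t \<Longrightarrow> eval right_power (map_gterm \<rho> t) = 0"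
proof (induction t)
  case (Prod s t)
  have zero: "right_power a 0 = 0" and nested: "right_power (right_power a b) c = 0" for a b c
    by (simp_all add: right_power_def)
  show ?case
  proof (cases s)
    case (Prod p q)
    then show ?thesis by (simp add: nested zero)
  qed (use Prod in \<open>auto simp: zero\<close>)
qed simp

lemma length_leaves_ge_2: "2 \<le> length (leaves t) \<Longrightarrow> \<exists>p q. t = p \<cdot> q"
  by (cases t) auto

lemma left_comb_decompose:
  assumes "left_comb t" "4 \<le> length (leaves t)"
  shows "\<exists>p q r s. t = ((p \<cdot> q) \<cdot> r) \<cdot> s"
proof -
  obtain t' s where t: "t = t' \<cdot> s"
    using length_leaves_ge_2[of t] assms by auto
  with assms obtain t'' r where t': "t' = t'' \<cdot> r"
    using length_leaves_ge_2[of t'] by auto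
  with t assms obtain p q where "t'' = p \<cdot> q"
    using length_leaves_ge_2[of t''] by auto
  with t t' show ?thesis by blast
qed

lemma right_comb_decompose:
  assumes "right_comb t" "4 \<le> length (leaves t)"
  shows "\<exists>p q r s. t = p \<cdot> (q \<cdot> (r \<cdot> s))"
proof -
  obtain p t' where t: "t = p \<cdot> t'"
    using length_leaves_ge_2[of t] assms by auto
  with assms obtain q t'' where t': "t' = q \<cdot> t''"
    using length_leaves_ge_2[of t'] by auto
  with t assms obtain r s where "t'' = r \<cdot> s"
    using length_leaves_ge_2[of t''] by auto
  with t t' show ?thesis by blast
qed

text \<open>No product equals 1, so above the innermost product each step along a left comb must
  multiply an odd number by 1 on the right. The result is even, which rules out a second such step.
  Right combs fail likewise with the parities exchanged. Four leaves provide the two steps.\<close>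

lemma eval_zigzag_power_eq_0:
  assumes "left_comb t \<or> right_comb t" "4 \<le> length (leaves t)"
  shows "eval zigzag_power (map_gterm \<rho> t) = 0"
proof -
  have "zigzag_power (zigzag_power (zigzag_power a b) c) d = 0"
    "zigzag_power a (zigzag_power b (zigzag_power c d)) = 0" for a b c d
    by (auto simp: zigzag_power_def)
  then show ?thesis
    using assms left_comb_decompose[of t] right_comb_decompose[of t] by auto
qed

text \<open>Attaching each 1 on the suitable side builds a power of value \<open>Suc k\<close>;
  attaching the last 1 on the other side gives 0 from the same leaves. The disjunctions let the
  suitable side vary with \<open>n\<close>, as it does for \<open>zigzag_power\<close>.\<close>

lemma not_nice_if_powers:
  fixes g :: "nat \<Rightarrow> nat \<Rightarrow> nat"
  assumes "infinite (UNIV :: 'a set)"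
    and "\<And>\<rho>. eval g (map_gterm \<rho> u) = 0" "\<And>\<rho>. eval g (map_gterm \<rho> v) = 0"
    and nonzero: "\<And>n. 1 \<le> n \<Longrightarrow> g n 1 = Suc n \<or> g 1 n = Suc n"
    and zero: "\<And>n. 2 \<le> n \<Longrightarrow> g n 1 = 0 \<or> g 1 n = 0"
  shows "\<not> ultimately_AC_nice_identity TYPE('a) (u, v)"
proof (rule not_ultimately_AC_nice_identity[of g, OF assms(1)])
  have power: "\<exists>t. leaves t = replicate (Suc k) 1 \<and> eval g t = Suc k" for k
  proof (induction k)
    case 0
    show ?case by (intro exI[of _ "Var 1"]) simp
  next
    case (Suc k)
    then obtain t where t: "leaves t = replicate (Suc k) 1" "eval g t = Suc k" by blast
    have "leaves (t \<cdot> Var 1) = replicate (Suc (Suc k)) 1"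
      "leaves (Var 1 \<cdot> t) = replicate (Suc (Suc k)) 1"
      by (simp_all add: t(1) replicate_append_same)
    moreover have "eval g (t \<cdot> Var 1) = Suc (Suc k) \<or> eval g (Var 1 \<cdot> t) = Suc (Suc k)"
      using nonzero[of "Suc k"] by (simp add: t(2))
    ultimately show ?case by blast
  qed
  fix k :: nat
  assume k: "2 \<le> k"
  obtain s where s: "leaves s = replicate (Suc k) 1" "eval g s = Suc k"
    using power by blast
  obtain t where t: "leaves t = replicate k 1" "eval g t = k"
    using power[of "k - 1"] k by auto
  have "mset (leaves (t \<cdot> Var 1)) = mset (leaves s)" "mset (leaves (Var 1 \<cdot> t)) = mset (leaves s)"
    by (simp_all add: s(1) t(1))
  moreover have "eval g (t \<cdot> Var 1) \<noteq> eval g s \<or> eval g (Var 1 \<cdot> t) \<noteq> eval g s"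
    using zero[OF k] by (auto simp: s(2) t(2))
  moreover have "length (leaves s) = Suc k"
    by (simp add: s(1))
  ultimately show "\<exists>s t. length (leaves s) = Suc k \<and> mset (leaves s) = mset (leaves t)
      \<and> eval g s \<noteq> eval g t"
    by metis
qed (simp add: assms(2,3))

section \<open>Classification\<close>

text \<open>Each conclusion excludes one power groupoid: if it failed, both sides would be
  constantly 0 there. With at least four leaves no term is a comb of both kinds, so the sides are
  opposite combs and \<open>zigzag_power\<close> vanishes on both.\<close>

lemma nice_imp_combs:
  assumes "infinite (UNIV :: 'a set)" "ultimately_AC_nice_identity TYPE('a) (u, v)"
    and "length (leaves u) = length (leaves v)"
  shows "left_comb u \<or> left_comb v" "right_comb u \<or> right_comb v" "length (leaves u) \<le> 3"
proof -
  show left: "left_comb u \<or> left_comb v"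
    using not_nice_if_powers[of left_power u v, OF assms(1)] eval_left_power_eq_0 assms(2)
    by (fastforce simp: left_power_def)
  show right: "right_comb u \<or> right_comb v"
    using not_nice_if_powers[of right_power u v, OF assms(1)] eval_right_power_eq_0 assms(2)
    by (fastforce simp: right_power_def)
  have not_both: "\<not> (left_comb t \<and> right_comb t)" if "4 \<le> length (leaves t)" for t :: "nat gterm"
    using that by (cases t) auto
  show "length (leaves u) \<le> 3"
  proof (rule ccontr)
    assume "\<not> length (leaves u) \<le> 3"
    then have "4 \<le> length (leaves u)" "4 \<le> length (leaves v)"
      using assms(3) by auto
    then have "eval zigzag_power (map_gterm \<rho> u) = 0" "eval zigzag_power (map_gterm \<rho> v) = 0" for \<rho>
      using left right not_both eval_zigzag_power_eq_0 by blast+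
    then have "\<not> ultimately_AC_nice_identity TYPE('a) (u, v)"
      by (rule not_nice_if_powers[OF assms(1)]) (auto simp: zigzag_power_def)
    with assms(2) show False by simp
  qed
qed

text \<open>One variable would give equal first variables, and two leave only the commutative law.
  With three, \<open>v\<close> must be a right comb whose first and last variables both differ from
  those of \<open>u\<close>.\<close>

lemma nice_left_comb_cases:
  assumes inf: "infinite (UNIV :: 'a set)"
    and nice: "ultimately_AC_nice_identity TYPE('a) (u, v)"
    and lin: "linear_identity l (u, v)" and "left_comb u"
  obtains a b c where "distinct [a, b, c]"
    "u = (Var a \<cdot> Var b) \<cdot> Var c" "v = Var b \<cdot> (Var c \<cdot> Var a)"
proof -
  have dist: "distinct (leaves u)" "distinct (leaves v)" and set_eq: "set (leaves u) = set (leaves v)"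
    using lin by (auto simp: linear_identity_def)
  then have len: "length (leaves u) = length (leaves v)"
    by (metis distinct_card)
  note combs = nice_imp_combs[OF inf nice len]
  have hd: "hd (leaves u) \<noteq> hd (leaves v)" and last: "last (leaves u) \<noteq> last (leaves v)"
    using not_nice_if_hd_eq not_nice_if_last_eq inf nice by blast+
  have not_comm: False if "\<And>(g :: nat \<Rightarrow> nat \<Rightarrow> nat) \<rho>. (\<And>x y. g x y = g y x) \<Longrightarrow>
      eval g (map_gterm \<rho> u) = eval g (map_gterm \<rho> v)"
    using not_nice_if_commutative[OF inf that] nice by blast
  consider "length (leaves u) = 1" | "length (leaves u) = 2" | "length (leaves u) = 3"
    using combs(3) length_leaves_pos[of u] by linarith
  then show thesis
  proof cases
    case 1
    then obtain a b where "u = Var a" "v = Var b"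
      using len length_leaves_1 by metis
    with set_eq hd show ?thesis by simp
  next
    case 2
    then obtain a b c d where uv: "u = Var a \<cdot> Var b" "v = Var c \<cdot> Var d"
      using len length_leaves_2 by metis
    with set_eq hd have "c = b" "d = a" by auto
    with uv not_comm show ?thesis by simp
  next
    case 3
    then obtain p q where "u = p \<cdot> q"
      using length_leaves_ge_2[of u] by auto
    with 3 \<open>left_comb u\<close> have "\<not> right_comb u" and pq: "length (leaves p) = 2" "length (leaves q) = 1"
      by auto
    with \<open>u = p \<cdot> q\<close> obtain a b c where u: "u = (Var a \<cdot> Var b) \<cdot> Var c"
      by (metis length_leaves_1 length_leaves_2)
    obtain r t where "v = r \<cdot> t"
      using 3 len length_leaves_ge_2[of v] by auto
    with combs(2) \<open>\<not> right_comb u\<close> 3 len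
    have "length (leaves r) = 1" "length (leaves t) = 2" by auto
    with \<open>v = r \<cdot> t\<close> obtain a' b' c' where v: "v = Var a' \<cdot> (Var b' \<cdot> Var c')"
      by (metis length_leaves_1 length_leaves_2)
    have "a' \<in> {a, b, c}" "b' \<in> {a, b, c}" "c' \<in> {a, b, c}"
      using set_eq by (auto simp: u v)
    moreover have "distinct [a', b', c']" "a' \<noteq> a" "c' \<noteq> c"
      using dist hd last by (simp_all add: u v)
    \<comment> \<open>Of the six orders exactly these three change both ends; the last two give
      consequences of commutativity.\<close>
    ultimately consider "a' = b" "b' = c" "c' = a" | "a' = c" "b' = a" "c' = b"
      | "a' = c" "b' = b" "c' = a"
      by force
    then show ?thesis
    proof cases
      case 1
      from dist(1) have "distinct [a, b, c]" by (simp add: u)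
      then show ?thesis
        using u v unfolding 1 by (rule that)
    next
      case 2
      have "eval g (map_gterm \<rho> u) = eval g (map_gterm \<rho> v)"
        if "\<And>x y. g x y = g y x" for g :: "nat \<Rightarrow> nat \<Rightarrow> nat" and \<rho>
        unfolding u v 2 by (simp add: that[of "g _ _"])
      then show ?thesis
        using not_comm by blast
    next
      case 3
      have "eval g (map_gterm \<rho> u) = eval g (map_gterm \<rho> v)"
        if "\<And>x y. g x y = g y x" for g :: "nat \<Rightarrow> nat \<Rightarrow> nat" and \<rho>
        unfolding u v 3 by (simp add: that[of "g _ _"] that[of "\<rho> a"])
      then show ?thesis
        using not_comm by blast
    qed
  qed
qed

section \<open>The cyclic identity up to renaming and orientation\<close>

lemma map_gterm_eq_Var: "map_gterm \<sigma> t = Var x \<longleftrightarrow> (\<exists>a. t = Var a \<and> \<sigma> a = x)"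
  by (cases t) auto

lemma map_gterm_eq_Prod:
  "map_gterm \<sigma> t = p \<cdot> q \<longleftrightarrow> (\<exists>t1 t2. t = t1 \<cdot> t2 \<and> map_gterm \<sigma> t1 = p \<and> map_gterm \<sigma> t2 = q)"
  by (cases t) auto

text \<open>Distinct variables can be assigned values independently, so the one identity yields the
  locale axiom for all triples.\<close>

lemma cyclic_groupoid_if_satisfies:
  assumes "distinct [a, b, c]" "groupoid G f"
    and sat: "satisfies G f ((Var a \<cdot> Var b) \<cdot> Var c, Var b \<cdot> (Var c \<cdot> Var a))"
  shows "cyclic_groupoid G f"
proof
  show "f x y \<in> G" if "x \<in> G" "y \<in> G" for x y
    using that assms(2) by (auto simp: groupoid_def)
  show "f (f x y) z = f y (f z x)" if "x \<in> G" "y \<in> G" "z \<in> G" for x y z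
  proof -
    have "(\<lambda>i. if i = a then x else if i = b then y else z) \<in> UNIV \<rightarrow> G"
      using that by auto
    with sat assms(1) show ?thesis
      by (fastforce simp: satisfies_def)
  qed
qed

lemma linear_and_nice_if_cyclic:
  assumes "distinct [a, b, c]"
    and e: "e = ((Var a \<cdot> Var b) \<cdot> Var c, Var b \<cdot> (Var c \<cdot> Var a)) \<or>
      e = (Var b \<cdot> (Var c \<cdot> Var a), (Var a \<cdot> Var b) \<cdot> Var c)"
  shows "(\<exists>l. linear_identity l e) \<and> ultimately_AC_nice_identity TYPE('a) e"
proof
  show "\<exists>l. linear_identity l e"
    using e assms(1) by (auto simp: linear_identity_def)
  have "satisfies G f ((Var a \<cdot> Var b) \<cdot> Var c, Var b \<cdot> (Var c \<cdot> Var a))"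
    if "satisfies G f e" for G :: "'a set" and f
    using e that by (auto simp: satisfies_def)
  then have "AC_nice 5 G f" if "groupoid G f" "satisfies G f e" for G :: "'a set" and f
    using that assms(1) cyclic_groupoid_if_satisfies cyclic_groupoid.AC_nice_5 by blast
  then show "ultimately_AC_nice_identity TYPE('a) e"
    unfolding ultimately_AC_nice_identity_def ultimately_AC_nice_def
    by (auto intro: exI[of _ 5])
qed

text \<open>Trades the renaming for explicit variables, the form in which the classification and its
  converse are stated.\<close>

lemma same_identity_cyclic_iff:
  assumes "distinct [x, y, z]"
  shows "same_identity e ((Var x \<cdot> Var y) \<cdot> Var z, Var y \<cdot> (Var z \<cdot> Var x)) \<longleftrightarrow>
    (\<exists>a b c. distinct [a, b, c] \<and> (e = ((Var a \<cdot> Var b) \<cdot> Var c, Var b \<cdot> (Var c \<cdot> Var a)) \<or>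
      e = (Var b \<cdot> (Var c \<cdot> Var a), (Var a \<cdot> Var b) \<cdot> Var c)))"
    (is "?L \<longleftrightarrow> ?R")
proof
  assume ?L
  then obtain u v \<sigma> where e: "e = (u, v)" and inj: "inj_on \<sigma> (set (leaves u) \<union> set (leaves v))"
    and "map_gterm \<sigma> u = (Var x \<cdot> Var y) \<cdot> Var z \<and> map_gterm \<sigma> v = Var y \<cdot> (Var z \<cdot> Var x) \<or>
      map_gterm \<sigma> v = (Var x \<cdot> Var y) \<cdot> Var z \<and> map_gterm \<sigma> u = Var y \<cdot> (Var z \<cdot> Var x)"
    by (cases e) (auto simp: same_identity_def)
  then show ?R
  proof (elim disjE conjE)
    assume "map_gterm \<sigma> u = (Var x \<cdot> Var y) \<cdot> Var z" "map_gterm \<sigma> v = Var y \<cdot> (Var z \<cdot> Var x)"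
    then obtain a b c a' b' c' where "u = (Var a \<cdot> Var b) \<cdot> Var c" "v = Var b' \<cdot> (Var c' \<cdot> Var a')"
      and "\<sigma> a = x" "\<sigma> b = y" "\<sigma> c = z" "\<sigma> a' = x" "\<sigma> b' = y" "\<sigma> c' = z"
      by (auto simp: map_gterm_eq_Prod map_gterm_eq_Var)
    \<comment> \<open>Injectivity across both sides identifies the variables of \<open>u\<close> and
      \<open>v\<close> that have the same image.\<close>
    moreover from this have "a' = a" "b' = b" "c' = c"
      using inj_onD[OF inj, of a' a] inj_onD[OF inj, of b' b] inj_onD[OF inj, of c' c] by simp_all
    ultimately show ?R
      using e assms by (intro exI[of _ a] exI[of _ b] exI[of _ c]) auto
  next
    assume "map_gterm \<sigma> v = (Var x \<cdot> Var y) \<cdot> Var z" "map_gterm \<sigma> u = Var y \<cdot> (Var z \<cdot> Var x)"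
    then obtain a b c a' b' c' where "v = (Var a \<cdot> Var b) \<cdot> Var c" "u = Var b' \<cdot> (Var c' \<cdot> Var a')"
      and "\<sigma> a = x" "\<sigma> b = y" "\<sigma> c = z" "\<sigma> a' = x" "\<sigma> b' = y" "\<sigma> c' = z"
      by (auto simp: map_gterm_eq_Prod map_gterm_eq_Var)
    moreover from this have "a' = a" "b' = b" "c' = c"
      using inj_onD[OF inj, of a' a] inj_onD[OF inj, of b' b] inj_onD[OF inj, of c' c] by simp_all
    ultimately show ?R
      using e assms by (intro exI[of _ a] exI[of _ b] exI[of _ c]) auto
  qed
next
  assume ?R
  then obtain a b c where "distinct [a, b, c]"
    and e: "e = ((Var a \<cdot> Var b) \<cdot> Var c, Var b \<cdot> (Var c \<cdot> Var a)) \<or>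
      e = (Var b \<cdot> (Var c \<cdot> Var a), (Var a \<cdot> Var b) \<cdot> Var c)"
    by blast
  \<comment> \<open>All variables except \<open>a\<close> and \<open>b\<close> go to
    \<open>z\<close>, which is still injective on the three variables that occur.\<close>
  moreover define \<sigma> where "\<sigma> i = (if i = a then x else if i = b then y else z)" for i
  ultimately have \<sigma>: "inj_on \<sigma> {a, b, c}" "\<sigma> a = x" "\<sigma> b = y" "\<sigma> c = z"
    using assms by (auto simp: inj_on_def)
  obtain u v where uv: "e = (u, v)" by (cases e)
  have leaves_uv: "set (leaves u) \<union> set (leaves v) = {a, b, c}"
    using e by (auto simp: uv)
  have "(map_gterm \<sigma> u, map_gterm \<sigma> v) = ((Var x \<cdot> Var y) \<cdot> Var z, Var y \<cdot> (Var z \<cdot> Var x)) \<or>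
    (map_gterm \<sigma> v, map_gterm \<sigma> u) = ((Var x \<cdot> Var y) \<cdot> Var z, Var y \<cdot> (Var z \<cdot> Var x))"
    using e by (auto simp: uv \<sigma>)
  with \<sigma>(1) show ?L
    unfolding same_identity_def uv prod.case leaves_uv by metis
qed

theorem theorem5p6:
  fixes e :: identity and x y z :: nat
  assumes "infinite (UNIV :: 'a set)"
    and "distinct [x, y, z]"
  shows "(\<exists>l. linear_identity l e) \<and> ultimately_AC_nice_identity TYPE('a) e
    \<longleftrightarrow> same_identity e ((Var x \<cdot> Var y) \<cdot> Var z, Var y \<cdot> (Var z \<cdot> Var x))"
  unfolding same_identity_cyclic_iff[OF assms(2)]
proof
  obtain u v where e: "e = (u, v)" by (cases e)
  assume "(\<exists>l. linear_identity l e) \<and> ultimately_AC_nice_identity TYPE('a) e"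
  then obtain l where lin: "linear_identity l (u, v)"
    and nice: "ultimately_AC_nice_identity TYPE('a) (u, v)"
    using e by blast
  \<comment> \<open>Linearity and niceness are symmetric in the two sides, so either side may play
    the left comb.\<close>
  have lin': "linear_identity l (v, u)"
    using lin by (auto simp: linear_identity_def)
  have nice': "ultimately_AC_nice_identity TYPE('a) (v, u)"
    using nice by (auto simp: ultimately_AC_nice_identity_def satisfies_def)
  have "length (leaves u) = length (leaves v)"
    using lin by (auto simp: linear_identity_def simp flip: distinct_card)
  then have "left_comb u \<or> left_comb v"
    by (rule nice_imp_combs(1)[OF assms(1) nice])
  then show "\<exists>a b c. distinct [a, b, c] \<and>
      (e = ((Var a \<cdot> Var b) \<cdot> Var c, Var b \<cdot> (Var c \<cdot> Var a)) \<or>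
       e = (Var b \<cdot> (Var c \<cdot> Var a), (Var a \<cdot> Var b) \<cdot> Var c))"
    using nice_left_comb_cases[OF assms(1) nice lin] nice_left_comb_cases[OF assms(1) nice' lin'] e
    by metis
qed (use linear_and_nice_if_cyclic in blast)

end
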